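(* Let $D\subseteq\mathbb{C}$ be open, let $\varphi_1,\varphi_2,\psi$ be analytic functions on $D$, let $\alpha,\beta\in\mathbb{R}^{+}\setminus\{1\}$, and for $n=0,1,2,\dots$ let $\Theta_n(x)=\alpha^{\varphi_1(x)}\frac{d^n}{dx^n}\left(\psi(x)\beta^{-\varphi_2(x)}\right)$. Then for all $n\ge 0$ and $x\in D$, $$\sum_{p=0}^{n}\binom{n}{p}\left\{\Theta_{n-p+1}(x)\psi^{(p)}(x)-\Theta_{n-p}(x)\psi^{(p+1)}(x)\right\}=-\ln\beta\sum_{k=0}^{n}\sum_{p=0}^{n-k}\binom{n}{k}\binom{n-k}{p}\Theta_{n-p-k}(x)\psi^{(p)}(x)\varphi_2^{(k+1)}(x)$$ and $$\sum_{p=0}^{n}\binom{n}{p}\left\{\Theta_{n-p}'(x)\psi^{(p)}(x)-\ln\alpha\,\varphi_1'(x)\Theta_{n-p}(x)\psi^{(p)}(x)-\Theta_{n-p}(x)\psi^{(p+1)}(x)\right\}=-\ln\beta\sum_{k=0}^{n}\sum_{p=0}^{n-k}\binom{n}{k}\binom{n-k}{p}\Theta_{n-p-k}(x)\psi^{(p)}(x)\varphi_2^{(k+1)}(x).$$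
   Context: For $c>0$ and $w\in\mathbb{C}$, $c^{w}=e^{w\ln c}$ with $\ln$ the real natural logarithm. Primes and superscripts $(p)$ denote derivatives with respect to $x$. *)

theory Defs
  imports "HOL-Complex_Analysis.Complex_Analysis"
begin

(* For a positive real base the principal branch used by powr gives exactly
   c^w = exp (w * ln c) with the real logarithm. *)
lemma powr_pos_real_base:
  fixes c :: real and w :: complex
  assumes "c > 0"
  shows "complex_of_real c powr w = exp (w * complex_of_real (ln c))"
  using assms by (simp add: powr_def Ln_of_real)

(* The functions are total on the complex plane; the iterated derivative at a point of an open
   set D depends only on the values on D. *)
definition Theta ::
  "real \<Rightarrow> real \<Rightarrow> (complex \<Rightarrow> complex) \<Rightarrow> (complex \<Rightarrow> complex) \<Rightarrow> (complex \<Rightarrow> complex)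
     \<Rightarrow> nat \<Rightarrow> complex \<Rightarrow> complex" where
  "Theta \<alpha> \<beta> \<phi>1 \<phi>2 \<psi> n x =
     complex_of_real \<alpha> powr \<phi>1 x *
     (deriv ^^ n) (\<lambda>z. \<psi> z * complex_of_real \<beta> powr (- \<phi>2 z)) x"

end

theory Submission
  imports Defs
begin

text \<open>
  The function f = \<psi> \<beta>^(-\<phi>2) satisfies
  f' \<psi> - f \<psi>' = -ln \<beta> \<cdot> \<phi>2' \<psi> f. Differentiating this identity n times by the
  Leibniz rule and multiplying by \<alpha>^\<phi>1 gives the first equation. The second follows from the
  first, since \<Theta>_m' = ln \<alpha> \<cdot> \<phi>1' \<Theta>_m + \<Theta>_(m+1).
\<close>

text \<open>A positive base turns the power into the entire function \<open>exp\<close> applied to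
  \<open>g z * ln c\<close>, so the chain rule applies wherever \<open>g\<close> is differentiable,
  with no branch cut to avoid.\<close>

lemma has_field_derivative_pos_powr:
  fixes c :: real and g :: "complex \<Rightarrow> complex"
  assumes "c > 0" and "(g has_field_derivative g') (at x)"
  shows "((\<lambda>z. complex_of_real c powr g z) has_field_derivative
           complex_of_real (ln c) * g' * complex_of_real c powr g x) (at x)"
  unfolding powr_pos_real_base[OF assms(1)]
  by (auto intro!: derivative_eq_intros assms(2) simp: mult_ac)

lemma holomorphic_on_pos_powr:
  fixes c :: real
  assumes "c > 0" and "g holomorphic_on D"
  shows "(\<lambda>z. complex_of_real c powr g z) holomorphic_on D"
  unfolding powr_pos_real_base[OF assms(1)] by (intro holomorphic_intros assms(2))

text \<open>By the product rule the two terms with \<open>deriv \<psi> x\<close> cancel, and only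
  the derivative of the exponential factor survives. Where \<psi> does not vanish this is the
  quotient rule for \<open>f / \<psi>\<close> multiplied by the square of \<psi>; the form without
  division also covers the zeros of \<psi>.\<close>

lemma weighted_wronskian:
  fixes \<beta> :: real and \<phi> \<psi> :: "complex \<Rightarrow> complex"
  defines "f \<equiv> \<lambda>z. \<psi> z * complex_of_real \<beta> powr (- \<phi> z)"
  assumes "\<beta> > 0" and \<phi>: "\<phi> field_differentiable at x" and \<psi>: "\<psi> field_differentiable at x"
  shows "\<psi> x * deriv f x - deriv \<psi> x * f x
           = - complex_of_real (ln \<beta>) * (deriv \<phi> x * (\<psi> x * f x))"
proof -
  note d = field_differentiable_derivI
  have "(f has_field_derivative
      \<psi> x * (complex_of_real (ln \<beta>) * (- deriv \<phi> x) * complex_of_real \<beta> powr (- \<phi> x))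
      + deriv \<psi> x * complex_of_real \<beta> powr (- \<phi> x)) (at x)"
    unfolding f_def
    by (intro DERIV_mult' d[OF \<psi>] has_field_derivative_pos_powr \<open>\<beta> > 0\<close> DERIV_minus d[OF \<phi>])
  then show ?thesis
    by (simp add: DERIV_imp_deriv f_def algebra_simps)
qed

text \<open>On the left, Leibniz acts on each of the two products. On the right it acts twice on
  \<open>deriv \<phi> * (\<psi> * f)\<close>: \<open>k\<close> counts the derivatives that fall on
  \<open>deriv \<phi>\<close>, \<open>p\<close> those on \<psi>, and the remaining
  \<open>n - k - p\<close> fall on \<open>f\<close>.\<close>

lemma weighted_wronskian_higher_deriv:
  fixes \<beta> :: real and \<phi> \<psi> :: "complex \<Rightarrow> complex"
  defines "f \<equiv> \<lambda>z. \<psi> z * complex_of_real \<beta> powr (- \<phi> z)"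
  assumes "open D" and "\<phi> holomorphic_on D" and "\<psi> holomorphic_on D" and "\<beta> > 0" and "x \<in> D"
  shows "(\<Sum>p=0..n. of_nat (n choose p) *
            ((deriv ^^ (n - p + 1)) f x * (deriv ^^ p) \<psi> x
             - (deriv ^^ (n - p)) f x * (deriv ^^ (p + 1)) \<psi> x))
    = - complex_of_real (ln \<beta>) *
        (\<Sum>k=0..n. \<Sum>p=0..n - k. of_nat (n choose k) * of_nat ((n - k) choose p) *
           (deriv ^^ (n - p - k)) f x * (deriv ^^ p) \<psi> x * (deriv ^^ (k + 1)) \<phi> x)"
proof -
  have f: "f holomorphic_on D"
    unfolding f_def by (intro holomorphic_intros holomorphic_on_pos_powr assms)
  note hol = f assms(3,4) holomorphic_deriv[OF f \<open>open D\<close>]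
    holomorphic_deriv[OF assms(3) \<open>open D\<close>] holomorphic_deriv[OF assms(4) \<open>open D\<close>]
  \<comment> \<open>Leibniz produces iterated derivatives of \<open>deriv f\<close>,
    \<open>deriv \<psi>\<close> and \<open>deriv \<phi>\<close>; this is the source of every order
    shifted by one.\<close>
  have Suc: "(deriv ^^ m) (deriv g) = (deriv ^^ (m + 1)) g" for m and g :: "complex \<Rightarrow> complex"
    by (simp add: funpow_swap1)
  note leibniz = higher_deriv_mult[OF _ _ \<open>open D\<close> \<open>x \<in> D\<close>]
  \<comment> \<open>The first-order identity is available only at points of \<open>D\<close>. Since
    \<open>D\<close> is open, agreement there is enough for the higher derivatives at
    \<open>x\<close> to agree.\<close>
  have "(deriv ^^ n) (\<lambda>z. \<psi> z * deriv f z - deriv \<psi> z * f z) x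
      = (deriv ^^ n) (\<lambda>z. - complex_of_real (ln \<beta>) * (deriv \<phi> z * (\<psi> z * f z))) x"
  proof (rule higher_deriv_transform_within_open[OF _ _ \<open>open D\<close> \<open>x \<in> D\<close>])
    fix z assume "z \<in> D"
    then show "\<psi> z * deriv f z - deriv \<psi> z * f z
        = - complex_of_real (ln \<beta>) * (deriv \<phi> z * (\<psi> z * f z))"
      unfolding f_def using assms
      by (intro weighted_wronskian) (auto simp: holomorphic_on_imp_differentiable_at)
  qed (intro holomorphic_intros hol)+
  moreover have "(deriv ^^ n) (\<lambda>z. \<psi> z * deriv f z - deriv \<psi> z * f z) x
      = (\<Sum>p=0..n. of_nat (n choose p) *
            ((deriv ^^ (n - p + 1)) f x * (deriv ^^ p) \<psi> x
             - (deriv ^^ (n - p)) f x * (deriv ^^ (p + 1)) \<psi> x))"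
  proof -
    have "(deriv ^^ n) (\<lambda>z. \<psi> z * deriv f z - deriv \<psi> z * f z) x
        = (deriv ^^ n) (\<lambda>z. \<psi> z * deriv f z) x - (deriv ^^ n) (\<lambda>z. deriv \<psi> z * f z) x"
      by (rule higher_deriv_diff[OF _ _ \<open>open D\<close> \<open>x \<in> D\<close>]) (intro holomorphic_intros hol)+
    also have "\<dots> = (\<Sum>p=0..n. of_nat (n choose p) * (deriv ^^ p) \<psi> x * (deriv ^^ (n - p + 1)) f x)
        - (\<Sum>p=0..n. of_nat (n choose p) * (deriv ^^ (p + 1)) \<psi> x * (deriv ^^ (n - p)) f x)"
      \<comment> \<open>In both products the factor from \<psi> stands first, so the index
        \<open>p\<close> counts its derivatives and the two sums can be merged term by term.\<close>
      by (simp only: leibniz hol Suc)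
    finally show ?thesis
      by (simp add: sum_subtractf right_diff_distrib mult_ac)
  qed
  moreover have "(deriv ^^ n) (\<lambda>z. - complex_of_real (ln \<beta>) * (deriv \<phi> z * (\<psi> z * f z))) x
      = - complex_of_real (ln \<beta>) * (deriv ^^ n) (\<lambda>z. deriv \<phi> z * (\<psi> z * f z)) x"
    by (rule higher_deriv_cmult[OF _ \<open>x \<in> D\<close> \<open>open D\<close>]) (intro holomorphic_intros hol)
  moreover have "(deriv ^^ n) (\<lambda>z. deriv \<phi> z * (\<psi> z * f z)) x
      = (\<Sum>k=0..n. of_nat (n choose k) * (deriv ^^ (k + 1)) \<phi> x *
           (\<Sum>p=0..n - k. of_nat ((n - k) choose p) * (deriv ^^ p) \<psi> x * (deriv ^^ (n - k - p)) f x))"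
    \<comment> \<open>Reading order \<open>k + 1\<close> of \<phi> as order \<open>k\<close> of
      \<open>deriv \<phi>\<close> brings the claim into the shape of two nested Leibniz
      expansions.\<close>
    unfolding Suc[symmetric] by (simp add: leibniz hol holomorphic_on_mult)
  moreover have "\<dots> = (\<Sum>k=0..n. \<Sum>p=0..n - k. of_nat (n choose k) * of_nat ((n - k) choose p) *
           (deriv ^^ (n - p - k)) f x * (deriv ^^ p) \<psi> x * (deriv ^^ (k + 1)) \<phi> x)"
    \<comment> \<open>Besides reordering factors, this identifies \<open>n - k - p\<close> with
      \<open>n - p - k\<close>, which holds for truncated subtraction too.\<close>
    unfolding sum_distrib_left by (intro sum.cong refl) (simp add: mult_ac add.commute)
  ultimately show ?thesis
    by simp
qed

text \<open>The prefactor with base \<alpha> stands outside the iterated derivative. The product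
  rule therefore gives one term from differentiating the prefactor, and one in which the iterated
  derivative rises from order \<open>m\<close> to \<open>m + 1\<close>.\<close>

lemma deriv_Theta:
  assumes "open D" and "\<phi>1 holomorphic_on D" and "\<phi>2 holomorphic_on D" and "\<psi> holomorphic_on D"
    and "\<alpha> > 0" and "\<beta> > 0" and "x \<in> D"
  shows "deriv (Theta \<alpha> \<beta> \<phi>1 \<phi>2 \<psi> m) x
    = complex_of_real (ln \<alpha>) * deriv \<phi>1 x * Theta \<alpha> \<beta> \<phi>1 \<phi>2 \<psi> m x + Theta \<alpha> \<beta> \<phi>1 \<phi>2 \<psi> (m + 1) x"
proof -
  define F where "F = (deriv ^^ m) (\<lambda>z. \<psi> z * complex_of_real \<beta> powr (- \<phi>2 z))"
  have "F holomorphic_on D"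
    unfolding F_def
    by (intro holomorphic_higher_deriv holomorphic_intros holomorphic_on_pos_powr assms)
  then have "(F has_field_derivative deriv F x) (at x)"
    using assms by (auto intro: holomorphic_derivI)
  moreover have "(\<phi>1 has_field_derivative deriv \<phi>1 x) (at x)"
    using assms by (auto intro: holomorphic_derivI)
  ultimately have "((\<lambda>z. complex_of_real \<alpha> powr \<phi>1 z * F z) has_field_derivative
      complex_of_real \<alpha> powr \<phi>1 x * deriv F x
      + complex_of_real (ln \<alpha>) * deriv \<phi>1 x * complex_of_real \<alpha> powr \<phi>1 x * F x) (at x)"
    using \<open>\<alpha> > 0\<close> by (intro DERIV_mult' has_field_derivative_pos_powr)
  then show ?thesis
    by (simp add: Theta_def[abs_def] F_def DERIV_imp_deriv)
qed

theorem theorem2: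
  fixes D :: "complex set"
    and \<phi>1 \<phi>2 \<psi> :: "complex \<Rightarrow> complex"
    and \<alpha> \<beta> :: real
    and \<Theta> :: "nat \<Rightarrow> complex \<Rightarrow> complex"
  assumes "open D"
    and "\<phi>1 analytic_on D" and "\<phi>2 analytic_on D" and "\<psi> analytic_on D"
    and "\<alpha> > 0" and "\<alpha> \<noteq> 1" and "\<beta> > 0" and "\<beta> \<noteq> 1"
  defines "\<Theta> \<equiv> Theta \<alpha> \<beta> \<phi>1 \<phi>2 \<psi>"
  shows "\<forall>n. \<forall>x\<in>D.
    (\<Sum>p=0..n. of_nat (n choose p) *
        (\<Theta> (n - p + 1) x * (deriv ^^ p) \<psi> x - \<Theta> (n - p) x * (deriv ^^ (p + 1)) \<psi> x))
      = - complex_of_real (ln \<beta>) *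
        (\<Sum>k=0..n. \<Sum>p=0..n - k. of_nat (n choose k) * of_nat ((n - k) choose p) *
           \<Theta> (n - p - k) x * (deriv ^^ p) \<psi> x * (deriv ^^ (k + 1)) \<phi>2 x)
    \<and>
    (\<Sum>p=0..n. of_nat (n choose p) *
        (deriv (\<Theta> (n - p)) x * (deriv ^^ p) \<psi> x
         - complex_of_real (ln \<alpha>) * deriv \<phi>1 x * \<Theta> (n - p) x * (deriv ^^ p) \<psi> x
         - \<Theta> (n - p) x * (deriv ^^ (p + 1)) \<psi> x))
      = - complex_of_real (ln \<beta>) *
        (\<Sum>k=0..n. \<Sum>p=0..n - k. of_nat (n choose k) * of_nat ((n - k) choose p) *
           \<Theta> (n - p - k) x * (deriv ^^ p) \<psi> x * (deriv ^^ (k + 1)) \<phi>2 x)"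
proof (intro allI ballI)
  fix n x assume x: "x \<in> D"
  have hol: "\<phi>1 holomorphic_on D" "\<phi>2 holomorphic_on D" "\<psi> holomorphic_on D"
    using assms by (auto intro: analytic_imp_holomorphic)
  define F where "F = (\<lambda>z. \<psi> z * complex_of_real \<beta> powr (- \<phi>2 z))"
  \<comment> \<open>At the fixed point \<open>x\<close> the prefactor is one common constant of all
    \<open>\<Theta> m x\<close>. Both sides of the first equation are linear in these values, so
    that equation is \<open>c\<close> times the identity for \<open>F\<close>.\<close>
  define c where "c = complex_of_real \<alpha> powr \<phi>1 x"
  have \<Theta>: "\<Theta> m x = c * (deriv ^^ m) F x" for m
    by (simp add: \<Theta>_def Theta_def F_def c_def)
  let ?L = "\<Sum>p=0..n. of_nat (n choose p) *
        (\<Theta> (n - p + 1) x * (deriv ^^ p) \<psi> x - \<Theta> (n - p) x * (deriv ^^ (p + 1)) \<psi> x)"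
  let ?L' = "\<Sum>p=0..n. of_nat (n choose p) *
        (deriv (\<Theta> (n - p)) x * (deriv ^^ p) \<psi> x
         - complex_of_real (ln \<alpha>) * deriv \<phi>1 x * \<Theta> (n - p) x * (deriv ^^ p) \<psi> x
         - \<Theta> (n - p) x * (deriv ^^ (p + 1)) \<psi> x)"
  let ?R = "- complex_of_real (ln \<beta>) *
        (\<Sum>k=0..n. \<Sum>p=0..n - k. of_nat (n choose k) * of_nat ((n - k) choose p) *
           \<Theta> (n - p - k) x * (deriv ^^ p) \<psi> x * (deriv ^^ (k + 1)) \<phi>2 x)"
  have "?L = c * (\<Sum>p=0..n. of_nat (n choose p) *
        ((deriv ^^ (n - p + 1)) F x * (deriv ^^ p) \<psi> x
         - (deriv ^^ (n - p)) F x * (deriv ^^ (p + 1)) \<psi> x))"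
    unfolding \<Theta> sum_distrib_left by (intro sum.cong refl) (simp only: algebra_simps)
  also have "\<dots> = c * (- complex_of_real (ln \<beta>) *
        (\<Sum>k=0..n. \<Sum>p=0..n - k. of_nat (n choose k) * of_nat ((n - k) choose p) *
           (deriv ^^ (n - p - k)) F x * (deriv ^^ p) \<psi> x * (deriv ^^ (k + 1)) \<phi>2 x))"
    unfolding F_def using weighted_wronskian_higher_deriv[OF \<open>open D\<close> hol(2,3) \<open>\<beta> > 0\<close> x] by metis
  also have "\<dots> = ?R"
    unfolding \<Theta> sum_distrib_left by (intro sum.cong refl) (simp only: mult_ac)
  finally have "?L = ?R" .
  \<comment> \<open>After inserting the derivative of \<open>\<Theta> (n - p)\<close>, the
    subtracted term with \<open>ln \<alpha>\<close> cancels in each summand and leaves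
    \<open>\<Theta> (n - p + 1) x\<close>.\<close>
  moreover have "?L' = ?L"
    unfolding \<Theta>_def
    by (simp only: deriv_Theta[OF \<open>open D\<close> hol \<open>\<alpha> > 0\<close> \<open>\<beta> > 0\<close> x] distrib_right
          add_diff_cancel_left')
  ultimately show "?L = ?R \<and> ?L' = ?R"
    by simp
qed

end
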